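(* For $m\ge 3$ and $n\geq 2$, the chromatic polynomial of the signed book graph $B^{uv}(m,n)=(B(m,n),\{uv\})$ satisfies \[\chi_{B^{uv}(m,n)}(\lambda)=(\lambda-1)\gamma_{m-1}\chi_{B^{uv}(m,n-1)}(\lambda)+(-1)^{m-2}(\lambda-1)^2\gamma_m^{n-1}\] and equals \[(\lambda-1)^{m+n-1}\gamma_{m-1}^{n-1}+(-1)^{m-2}\gamma_m(\lambda-1)^2\frac{(\lambda-1)^{n-1}\gamma_{m-1}^{n-1}-\gamma_m^{n-1}}{(\lambda-1)\gamma_{m-1}-\gamma_m},\] where $\gamma_j=\frac{(\lambda-1)^{j-1}-(-1)^{j-1}}{\lambda}$ for $j\ge 2$.
   Context: The book graph $B(m,n)$ has vertices $\{u,v\}\cup\{u_j^i:1\le i\le n,1\le j\le m-2\}$ and consists of the $n$ cycles $uu_1^i\cdots u_{m-2}^ivu$ sharing the edge $uv$. $B^{uv}(m,n)$ is the signed graph on $B(m,n)$ in which $uv$ is the only negative edge. For a signed graph with sign function $\sigma$, a proper coloring with colors $\{-k,\ldots,0,\ldots,k\}$ is a map $c$ with $c(x)\ne\sigma(e)c(y)$ for each edge $e=xy$; the chromatic polynomial is the polynomial whose value at $\lambda=2k+1$ counts proper colorings. *)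

theory Defs
  imports
    "HOL-Library.FuncSet"
    "HOL-Computational_Algebra.Computational_Algebra"
begin

text \<open>Undirected edges are two-element sets of vertices; the value of the sign function
  outside the edge set is irrelevant.\<close>

record 'v sgraph =
  verts :: "'v set"
  edges :: "'v set set"
  sign :: "'v set \<Rightarrow> int"

definition signed_graph :: "'v sgraph \<Rightarrow> bool" where
  "signed_graph G \<longleftrightarrow>
     finite (verts G) \<and>
     (\<forall>e \<in> edges G. e \<subseteq> verts G \<and> card e = 2) \<and>
     (\<forall>e \<in> edges G. sign G e \<in> {1, -1})"

definition proper_colorings :: "'v sgraph \<Rightarrow> nat \<Rightarrow> ('v \<Rightarrow> int) set" where
  "proper_colorings G k =
     {c \<in> verts G \<rightarrow>\<^sub>E {- int k..int k}.
        \<forall>x y. {x, y} \<in> edges G \<longrightarrow> c x \<noteq> sign G {x, y} * c y}"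

definition is_chromatic_poly :: "'v sgraph \<Rightarrow> int poly \<Rightarrow> bool" where
  "is_chromatic_poly G p \<longleftrightarrow>
     (\<forall>k::nat. poly p (2 * int k + 1) = int (card (proper_colorings G k)))"

definition chromatic_poly :: "'v sgraph \<Rightarrow> int poly" where
  "chromatic_poly G = (THE p. is_chromatic_poly G p)"

lemma is_chromatic_poly_unique:
  assumes "is_chromatic_poly G p" and "is_chromatic_poly G q"
  shows "p = q"
proof (rule ccontr)
  assume "p \<noteq> q"
  then have "finite {x. poly (p - q) x = 0}"
    by (intro poly_roots_finite) simp
  moreover have "range (\<lambda>k::nat. 2 * int k + 1) \<subseteq> {x. poly (p - q) x = 0}"
    using assms by (auto simp: is_chromatic_poly_def)
  ultimately have "finite (range (\<lambda>k::nat. 2 * int k + 1))"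
    by (rule finite_subset[rotated])
  moreover have "inj (\<lambda>k::nat. 2 * int k + 1)"
    by (auto simp: inj_on_def)
  ultimately show False
    using finite_imageD infinite_UNIV_nat by blast
qed

lemma chromatic_poly_eqI: "is_chromatic_poly G p \<Longrightarrow> chromatic_poly G = p"
  unfolding chromatic_poly_def by (blast intro: the_equality is_chromatic_poly_unique)

text \<open>\<open>W i j\<close> is the vertex written $u_j^i$, the \<open>j\<close>-th inner vertex of the \<open>i\<close>-th page.\<close>

datatype book_vertex = U | V | W nat nat

definition book_verts :: "nat \<Rightarrow> nat \<Rightarrow> book_vertex set" where
  "book_verts m n = {U, V} \<union> {W i j | i j. i \<in> {1..n} \<and> j \<in> {1..m - 2}}"

text \<open>The edges of the cycle $u\,u_1^i \cdots u_{m-2}^i\,v\,u$, for \<open>m \<ge> 3\<close>.\<close>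

definition page_edges :: "nat \<Rightarrow> nat \<Rightarrow> book_vertex set set" where
  "page_edges m i =
     {{U, W i 1}} \<union> {{W i j, W i (j + 1)} | j. 1 \<le> j \<and> j < m - 2} \<union>
     {{W i (m - 2), V}, {V, U}}"

definition signed_book :: "nat \<Rightarrow> nat \<Rightarrow> book_vertex sgraph" where
  "signed_book m n =
     \<lparr> verts = book_verts m n,
       edges = (\<Union>i \<in> {1..n}. page_edges m i),
       sign = (\<lambda>e. if e = {U, V} then -1 else 1) \<rparr>"

lemma signed_graph_signed_book:
  assumes "m \<ge> 3"
  shows "signed_graph (signed_book m n)"
proof -
  have "{W i j | i j. i \<in> {1..n} \<and> j \<in> {1..m - 2}} = case_prod W ` ({1..n} \<times> {1..m - 2})"
    by auto
  then have "finite (book_verts m n)"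
    by (simp add: book_verts_def)
  then show ?thesis
    using assms
    by (auto simp: signed_graph_def signed_book_def page_edges_def book_verts_def card_insert_if)
qed

text \<open>The formulas contain quotients, so they are read in the field of fractions of the
  polynomial ring, into which \<open>to_fract\<close> embeds the polynomials; \<open>/\<close> is then
  genuine division by a nonzero element.\<close>

definition lam :: "int poly fract" where
  "lam = to_fract [:0, 1:]"

definition gam :: "nat \<Rightarrow> int poly fract" where
  "gam j = ((lam - 1) ^ (j - 1) - (-1) ^ (j - 1)) / lam"

lemma lam_nonzero: "lam \<noteq> 0"
  by (simp add: lam_def)

lemma gam_diff:
  assumes "m \<ge> 3"
  shows "(lam - 1) * gam (m - 1) - gam m = (-1) ^ (m - 1)"
proof -
  define r where "r = m - 2"
  have m: "m - 1 = Suc r" "m - 1 - 1 = r"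
    using assms by (auto simp: r_def)
  have "((lam - 1) * gam (m - 1) - gam m) * lam
      = (lam - 1) * ((lam - 1) ^ r - (-1) ^ r) - ((lam - 1) ^ Suc r - (-1) ^ Suc r)"
    unfolding gam_def m left_diff_distrib using lam_nonzero by simp
  also have "\<dots> = (-1) ^ (m - 1) * lam"
    unfolding m by (simp add: algebra_simps)
  finally show ?thesis
    using lam_nonzero by simp
qed

abbreviation chi_book :: "nat \<Rightarrow> nat \<Rightarrow> int poly fract" where
  "chi_book m n \<equiv> to_fract (chromatic_poly (signed_book m n))"

end

theory Submission
  imports Defs
begin

text \<open>Fix the colours \<open>a\<close> and \<open>b\<close> of $u$ and $v$. A page is then coloured by a walk with
  $m - 1$ steps from \<open>a\<close> to \<open>b\<close> in the complete graph on the $q = 2k+1$ colours, independently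
  of the other pages. There are $\gamma_m$ such walks if $a \ne b$ and
  $\gamma_m + (-1)^{m-1} = (q-1)\gamma_{m-1}$ if $a = b$. The negative edge forbids $a = -b$,
  which leaves $q - 1$ pairs with $a = b$ (all but $a = b = 0$) and $(q-1)^2$ pairs with
  $a \ne b$. Hence the chromatic polynomial is
  $(q-1)((q-1)\gamma_{m-1})^n + (q-1)^2\gamma_m^n$, from which both formulas follow.\<close>

section \<open>Walk counts in complete graphs\<close>

text \<open>Over a field, the solution of this recursion is $((q-1)^s - (-1)^s)/q$; the recursion
  avoids the division, so that it also makes sense for polynomials and integers.\<close>

primrec walks :: "'a::comm_ring_1 \<Rightarrow> nat \<Rightarrow> 'a" where
  "walks q 0 = 0"
| "walks q (Suc s) = (q - 1) ^ s - walks q s"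

lemma walks_closed_form: "q * walks q s = (q - 1) ^ s - (-1) ^ s"
  by (induction s) (simp_all add: algebra_simps)

lemma poly_walks: "poly (walks p s) x = walks (poly p x) s"
  by (induction s) simp_all

lemma to_fract_power: "to_fract (x ^ n) = to_fract x ^ n"
  by (induction n) simp_all

lemma to_fract_walks: "to_fract (walks p s) = walks (to_fract p) s"
  by (induction s) (simp_all add: to_fract_power)

text \<open>A path on \<open>j\<close> vertices has \<open>j - 1\<close> steps, hence the shift
  between the indices.\<close>

lemma walks_lam: "walks lam s = gam (Suc s)"
  using walks_closed_form[of lam s] lam_nonzero by (simp add: gam_def field_simps)

section \<open>Colourings of a single page\<close>

text \<open>A walk is stored as the list of its \<open>r\<close> inner vertices only; the end
  colours \<open>a\<close> and \<open>b\<close> are parameters because all pages share them.\<close>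

definition page_colorings :: "'c set \<Rightarrow> nat \<Rightarrow> 'c \<Rightarrow> 'c \<Rightarrow> 'c list set" where
  "page_colorings C r a b =
     {xs. length xs = r \<and> set xs \<subseteq> C \<and> distinct_adj (a # xs @ [b])}"

lemma page_colorings_0: "page_colorings C 0 a b = (if a = b then {} else {[]})"
  by (auto simp: page_colorings_def)

lemma page_colorings_Suc:
  "page_colorings C (Suc r) a b = (\<Union>x \<in> C - {a}. (#) x ` page_colorings C r x b)"
proof (rule set_eqI)
  fix xs
  show "xs \<in> page_colorings C (Suc r) a b \<longleftrightarrow>
      xs \<in> (\<Union>x \<in> C - {a}. (#) x ` page_colorings C r x b)"
    by (cases xs) (auto simp: page_colorings_def)
qed

lemma finite_page_colorings: "finite C \<Longrightarrow> finite (page_colorings C r a b)"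
  by (induction r arbitrary: a) (auto simp: page_colorings_0 page_colorings_Suc)

text \<open>The first inner colour \<open>x\<close> is any of the \<open>q - 1\<close> colours other
  than \<open>a\<close>, and the rest is a walk from \<open>x\<close>. Each \<open>x\<close>
  contributes the off-diagonal count; the extra sign at \<open>x = b\<close> enters exactly when
  \<open>a \<noteq> b\<close>.\<close>

lemma card_page_colorings:
  assumes "finite C" "a \<in> C" "b \<in> C"
  shows "int (card (page_colorings C r a b)) =
    walks (int (card C)) (Suc r) + (if a = b then (-1) ^ Suc r else 0)"
  using assms(2)
proof (induction r arbitrary: a)
  case 0
  then show ?case by (simp add: page_colorings_0)
next
  case (Suc r)
  define q where "q = int (card C)"
  have q: "int (card (C - {a})) = q - 1"
    using assms(1) Suc.prems card_gt_0_iff[of C] by (auto simp: q_def of_nat_diff)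
  have "card (page_colorings C (Suc r) a b)
      = (\<Sum>x \<in> C - {a}. card ((#) x ` page_colorings C r x b))"
    unfolding page_colorings_Suc using assms(1)
    by (intro card_UN_disjoint) (auto simp: finite_page_colorings)
  then have "int (card (page_colorings C (Suc r) a b))
      = (\<Sum>x \<in> C - {a}. int (card (page_colorings C r x b)))"
    by (simp add: card_image)
  also have "\<dots> = (\<Sum>x \<in> C - {a}. walks q (Suc r) + (if x = b then (-1) ^ Suc r else 0))"
    by (intro sum.cong) (auto simp: Suc.IH q_def)
  also have "\<dots> = (q - 1) * walks q (Suc r) + (if a = b then 0 else (-1) ^ Suc r)"
    using assms(1,3) by (auto simp: sum.distrib q sum.delta)
  \<comment> \<open>Closed form and recursion give \<open>(q - 1) * walks q (Suc r) = walks q (Suc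
    (Suc r)) - (-1) ^ Suc r\<close>; for \<open>a \<noteq> b\<close> the sign cancels.\<close>
  also have "\<dots> = walks q (Suc (Suc r)) + (if a = b then (-1) ^ Suc (Suc r) else 0)"
    using walks_closed_form[of q "Suc r"] by (simp add: algebra_simps)
  finally show ?case by (simp add: q_def)
qed

section \<open>Proper colourings of the book, page by page\<close>

lemma distinct_adj_Cons_snoc:
  assumes "xs \<noteq> []"
  shows "distinct_adj (a # xs @ [b]) \<longleftrightarrow> a \<noteq> hd xs \<and> distinct_adj xs \<and> last xs \<noteq> b"
  using assms by (auto simp: distinct_adj_Cons distinct_adj_append_iff)

lemma distinct_adj_map_upt:
  "distinct_adj (map f [1..<Suc r]) \<longleftrightarrow> (\<forall>j. 1 \<le> j \<and> j < r \<longrightarrow> f j \<noteq> f (j + 1))"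
proof -
  have "distinct_adj (map f [1..<Suc r]) \<longleftrightarrow> (\<forall>i. Suc i < r \<longrightarrow> f (Suc i) \<noteq> f (Suc (Suc i)))"
    by (auto simp: distinct_adj_conv_nth simp del: upt_Suc)
  \<comment> \<open>The shift \<open>j = Suc i\<close> passes from list positions, counted from 0,
    to inner vertices, counted from 1.\<close>
  also have "\<dots> \<longleftrightarrow> (\<forall>j. 1 \<le> j \<and> j < r \<longrightarrow> f j \<noteq> f (j + 1))"
    by (metis One_nat_def Suc_eq_plus1 Suc_le_D Suc_le_mono le0)
  finally show ?thesis .
qed

definition page_restrict :: "nat \<Rightarrow> (book_vertex \<Rightarrow> 'c) \<Rightarrow> nat \<Rightarrow> 'c list" where
  "page_restrict m c i = map (\<lambda>j. c (W i j)) [1..<Suc (m - 2)]"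

text \<open>As \<open>m \<ge> 3\<close>, a page has an inner vertex, so its list of colours has a
  first and a last entry, which meet \<open>a\<close> and \<open>b\<close>. The right-hand side
  takes the shape of the edge conditions in \<open>edge_condition_signed_book\<close>.\<close>

lemma page_restrict_in_page_colorings:
  assumes "m \<ge> 3"
  shows "page_restrict m c i \<in> page_colorings C (m - 2) a b \<longleftrightarrow>
    (\<forall>j \<in> {1..m - 2}. c (W i j) \<in> C) \<and> a \<noteq> c (W i 1) \<and>
    (\<forall>j. 1 \<le> j \<and> j < m - 2 \<longrightarrow> c (W i j) \<noteq> c (W i (j + 1))) \<and> c (W i (m - 2)) \<noteq> b"
proof -
  have "hd (page_restrict m c i) = c (W i 1)" "page_restrict m c i \<noteq> []"
    using assms by (auto simp: page_restrict_def hd_map simp del: upt_Suc)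
  moreover have "last (page_restrict m c i) = c (W i (m - 2))"
  proof -
    obtain r where "m - 2 = Suc r" using assms by (cases "m - 2") auto
    then show ?thesis by (simp add: page_restrict_def)
  qed
  moreover have "set (page_restrict m c i) \<subseteq> C \<longleftrightarrow> (\<forall>j \<in> {1..m - 2}. c (W i j) \<in> C)"
    by (auto simp: page_restrict_def simp del: upt_Suc)
  moreover have "length (page_restrict m c i) = m - 2"
    by (simp add: page_restrict_def del: upt_Suc)
  moreover have "distinct_adj (page_restrict m c i) \<longleftrightarrow>
      (\<forall>j. 1 \<le> j \<and> j < m - 2 \<longrightarrow> c (W i j) \<noteq> c (W i (j + 1)))"
    unfolding page_restrict_def by (rule distinct_adj_map_upt)
  ultimately show ?thesis
    by (auto simp: page_colorings_def distinct_adj_Cons_snoc)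
qed

text \<open>Only \<open>{U, V}\<close> is negative; every other edge just demands different colours.
  The edge \<open>{U, V}\<close> enters through the pages, so \<open>n \<ge> 1\<close> is what puts
  it into the graph.\<close>

lemma edge_condition_signed_book:
  fixes c :: "book_vertex \<Rightarrow> int"
  assumes "n \<ge> 1"
  shows "(\<forall>x y. {x, y} \<in> edges (signed_book m n) \<longrightarrow> c x \<noteq> sign (signed_book m n) {x, y} * c y)
    \<longleftrightarrow> c U \<noteq> - c V \<and> (\<forall>i \<in> {1..n}. c U \<noteq> c (W i 1) \<and>
      (\<forall>j. 1 \<le> j \<and> j < m - 2 \<longrightarrow> c (W i j) \<noteq> c (W i (j + 1))) \<and> c (W i (m - 2)) \<noteq> c V)"
    (is "?L \<longleftrightarrow> ?R")
proof
  assume L: ?L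
  have edge: "c x \<noteq> sign (signed_book m n) {x, y} * c y"
    if "i \<in> {1..n}" "{x, y} \<in> page_edges m i" for x y i
  proof -
    have "{x, y} \<in> edges (signed_book m n)"
      using that by (auto simp: signed_book_def)
    then show ?thesis using L by blast
  qed
  show ?R
  proof (intro conjI ballI allI impI)
    show "c U \<noteq> - c V"
      using edge[of 1 U V] assms by (auto simp: page_edges_def signed_book_def insert_commute)
  next
    fix i assume i: "i \<in> {1..n}"
    show "c U \<noteq> c (W i 1)"
      using edge[OF i, of U "W i 1"]
      by (auto simp: page_edges_def signed_book_def doubleton_eq_iff)
    show "c (W i (m - 2)) \<noteq> c V"
      using edge[OF i, of "W i (m - 2)" V]
      by (auto simp: page_edges_def signed_book_def doubleton_eq_iff)
    fix j assume "1 \<le> j \<and> j < m - 2"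
    then have "{W i j, W i (j + 1)} \<in> page_edges m i"
      unfolding page_edges_def by blast
    from edge[OF i this] show "c (W i j) \<noteq> c (W i (j + 1))"
      by (auto simp: signed_book_def doubleton_eq_iff)
  qed
next
  assume R: ?R
  show ?L
  proof (intro allI impI)
    fix x y assume "{x, y} \<in> edges (signed_book m n)"
    then obtain i where i: "i \<in> {1..n}" and e: "{x, y} \<in> page_edges m i"
      by (auto simp: signed_book_def)
    have ends: "c U \<noteq> c (W i 1)" "c (W i (m - 2)) \<noteq> c V"
      using R i by blast+
    from e consider "{x, y} = {U, W i 1}"
      | j where "{x, y} = {W i j, W i (j + 1)}" "1 \<le> j" "j < m - 2"
      | "{x, y} = {W i (m - 2), V}" | "{x, y} = {V, U}"
      unfolding page_edges_def by blast
    then show "c x \<noteq> sign (signed_book m n) {x, y} * c y"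
    proof cases
      case 1
      then show ?thesis using ends by (auto simp: signed_book_def doubleton_eq_iff)
    next
      case 2
      then have "c (W i j) \<noteq> c (W i (j + 1))" using R i by blast
      with 2 show ?thesis by (auto simp: signed_book_def doubleton_eq_iff)
    next
      case 3
      then show ?thesis using ends by (auto simp: signed_book_def doubleton_eq_iff)
    next
      case 4
      then show ?thesis using R by (auto simp: signed_book_def doubleton_eq_iff)
    qed
  qed
qed

lemma proper_colorings_signed_book:
  assumes "m \<ge> 3" "n \<ge> 1"
  shows "c \<in> proper_colorings (signed_book m n) k \<longleftrightarrow>
    c \<in> extensional (book_verts m n) \<and>
    c U \<in> {- int k..int k} \<and> c V \<in> {- int k..int k} \<and> c U \<noteq> - c V \<and>
    (\<forall>i \<in> {1..n}. page_restrict m c i \<in> page_colorings {- int k..int k} (m - 2) (c U) (c V))"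
proof -
  have "c \<in> verts (signed_book m n) \<rightarrow>\<^sub>E {- int k..int k} \<longleftrightarrow>
      c \<in> extensional (book_verts m n) \<and>
      c U \<in> {- int k..int k} \<and> c V \<in> {- int k..int k} \<and>
      (\<forall>i \<in> {1..n}. \<forall>j \<in> {1..m - 2}. c (W i j) \<in> {- int k..int k})"
    unfolding PiE_def Pi_def by (simp add: signed_book_def) (auto simp: book_verts_def)
  then show ?thesis
    unfolding proper_colorings_def mem_Collect_eq edge_condition_signed_book[OF assms(2)]
      page_restrict_in_page_colorings[OF assms(1)]
    by blast
qed

text \<open>Once \<open>U\<close> and \<open>V\<close> are coloured, the pages do not constrain each
  other. The colourings thus form a disjoint union, over admissible end pairs, of
  \<open>n\<close>-fold products, and their number is a sum of \<open>n\<close>-th powers.\<close>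

lemma bij_betw_proper_colorings_signed_book:
  assumes "m \<ge> 3" "n \<ge> 1"
  defines "C k \<equiv> {- int k..int k}"
  shows "bij_betw (\<lambda>c. ((c U, c V), restrict (page_restrict m c) {1..n}))
    (proper_colorings (signed_book m n) k)
    (SIGMA p:{p \<in> C k \<times> C k. fst p \<noteq> - snd p}.
      {1..n} \<rightarrow>\<^sub>E page_colorings (C k) (m - 2) (fst p) (snd p))"
    (is "bij_betw ?f ?A ?B")
proof -
  \<comment> \<open>The inverse reads the colour of \<open>W i j\<close> at position
    \<open>j - 1\<close> of the \<open>i\<close>-th list; \<open>restrict\<close> makes the result
    extensional, as \<open>proper_colorings\<close> demands.\<close>
  define g :: "(int \<times> int) \<times> (nat \<Rightarrow> int list) \<Rightarrow> book_vertex \<Rightarrow> int" where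
    "g z = restrict (\<lambda>x. case x of U \<Rightarrow> fst (fst z) | V \<Rightarrow> snd (fst z)
      | W i j \<Rightarrow> snd z i ! (j - 1)) (book_verts m n)" for z
  have gU: "g z U = fst (fst z)" and gV: "g z V = snd (fst z)" for z
    by (auto simp: g_def book_verts_def)
  have gW: "page_restrict m (g z) i = snd z i"
    if "i \<in> {1..n}" "length (snd z i) = m - 2" for z i
    using that by (intro nth_equalityI)
      (auto simp: page_restrict_def g_def book_verts_def simp del: upt_Suc)
  have B: "snd z \<in> {1..n} \<rightarrow>\<^sub>E page_colorings (C k) (m - 2) (fst (fst z)) (snd (fst z))"
    if "z \<in> ?B" for z
    using that by (cases z) simp
  have page: "page_restrict m (g z) i = snd z i" if "z \<in> ?B" "i \<in> {1..n}" for z i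
    using PiE_mem[OF B[OF that(1)] that(2)]
    by (intro gW[OF that(2)]) (simp add: page_colorings_def)
  show ?thesis
  proof (rule bij_betw_byWitness[where f' = g])
    show "\<forall>c \<in> ?A. g (?f c) = c"
    proof
      fix c assume "c \<in> ?A"
      then have ext: "c \<in> extensional (book_verts m n)"
        unfolding proper_colorings_signed_book[OF assms(1,2)] by (rule conjunct1)
      show "g (?f c) = c"
      proof
        fix x
        show "g (?f c) x = c x"
        proof (cases "x \<in> book_verts m n")
          case True
          then show ?thesis
            by (auto simp: g_def book_verts_def page_restrict_def simp del: upt_Suc)
        next
          case False
          then show ?thesis by (simp add: g_def extensional_arb[OF ext])
        qed
      qed
    qed
    show "\<forall>z \<in> ?B. ?f (g z) = z"
    proof
      fix z assume z: "z \<in> ?B"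
      have "restrict (page_restrict m (g z)) {1..n} = restrict (snd z) {1..n}"
        by (intro restrict_ext page z)
      also have "\<dots> = snd z" by (rule PiE_restrict[OF B[OF z]])
      finally have "restrict (page_restrict m (g z)) {1..n} = snd z" .
      then show "?f (g z) = z" by (simp add: gU gV)
    qed
    show "?f ` ?A \<subseteq> ?B"
      unfolding C_def using proper_colorings_signed_book[OF assms(1,2)]
      by (intro image_subsetI) (simp add: PiE_iff)
    show "g ` ?B \<subseteq> ?A"
    proof
      fix c assume "c \<in> g ` ?B"
      then obtain z where z: "z \<in> ?B" and c: "c = g z" by blast
      have "page_restrict m c i \<in> page_colorings (C k) (m - 2) (c U) (c V)"
        if "i \<in> {1..n}" for i
        unfolding c page[OF z that] gU gV by (rule PiE_mem[OF B[OF z] that])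
      moreover have "c \<in> extensional (book_verts m n)" by (simp add: c g_def)
      moreover have "c U \<in> C k" "c V \<in> C k" "c U \<noteq> - c V"
        using z unfolding c gU gV by fastforce+
      ultimately show "c \<in> ?A"
        unfolding proper_colorings_signed_book[OF assms(1,2)] C_def by (intro conjI ballI)
    qed
  qed
qed

section \<open>Summation over the end colours\<close>

text \<open>Each \<open>a\<close> leaves \<open>2 * k\<close> choices of
  \<open>b \<noteq> - a\<close>. The choice \<open>b = a\<close> is among them unless
  \<open>a = - a\<close>, that is \<open>a = 0\<close>. So \<open>2 * k\<close> pairs are diagonal
  and \<open>(2 * k + 1) * (2 * k) - 2 * k = (2 * k)\<^sup>2\<close> are not.\<close>

lemma sum_nonopposite_pairs:
  fixes x y :: int
  shows "(\<Sum>p | p \<in> {- int k..int k} \<times> {- int k..int k} \<and> fst p \<noteq> - snd p.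
      if fst p = snd p then x else y) = 2 * int k * x + (2 * int k)\<^sup>2 * y"
proof -
  let ?C = "{- int k..int k}"
  have "(\<Sum>p | p \<in> ?C \<times> ?C \<and> fst p \<noteq> - snd p. if fst p = snd p then x else y)
      = (\<Sum>p \<in> (SIGMA a:?C. ?C - {- a}). if fst p = snd p then x else y)"
    by (intro sum.cong) auto
  also have "\<dots> = (\<Sum>a \<in> ?C. \<Sum>b \<in> ?C - {- a}. if a = b then x else y)"
    by (subst sum.Sigma) (auto simp: split_beta)
  also have "\<dots> = (\<Sum>a \<in> ?C. 2 * int k * y + (if a = 0 then 0 else x - y))"
  proof (rule sum.cong)
    fix a assume a: "a \<in> ?C"
    \<comment> \<open>The summand is the constant \<open>y\<close> plus a correction
      \<open>x - y\<close> at the single point \<open>b = a\<close>.\<close>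
    have "(\<Sum>b \<in> ?C - {- a}. if a = b then x else y)
        = (\<Sum>b \<in> ?C - {- a}. y + (if b = a then x - y else 0))"
      by (intro sum.cong) auto
    also have "\<dots> = int (card (?C - {- a})) * y + (if a \<in> ?C - {- a} then x - y else 0)"
      by (simp add: sum.distrib)
    also have "\<dots> = 2 * int k * y + (if a = 0 then 0 else x - y)"
      using a by auto
    finally show "(\<Sum>b \<in> ?C - {- a}. if a = b then x else y)
        = 2 * int k * y + (if a = 0 then 0 else x - y)" .
  qed simp
  also have "\<dots> = (\<Sum>a \<in> ?C. (2 * int k * y + (x - y)) - (if a = 0 then x - y else 0))"
    by (intro sum.cong) auto
  also have "\<dots> = 2 * int k * x + (2 * int k)\<^sup>2 * y"
    unfolding sum_subtractf by (simp add: algebra_simps power2_eq_square)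
  finally show ?thesis .
qed

lemma card_proper_colorings_signed_book:
  assumes "m \<ge> 3" "n \<ge> 1"
  shows "int (card (proper_colorings (signed_book m n) k)) =
    2 * int k * (walks (2 * int k + 1) (m - 1) + (-1) ^ (m - 1)) ^ n
    + (2 * int k)\<^sup>2 * walks (2 * int k + 1) (m - 1) ^ n"
proof -
  let ?C = "{- int k..int k}"
  let ?P = "{p \<in> ?C \<times> ?C. fst p \<noteq> - snd p}"
  let ?S = "\<lambda>p. page_colorings ?C (m - 2) (fst p) (snd p)"
  let ?w = "walks (2 * int k + 1) (m - 1)"
  have m: "Suc (m - 2) = m - 1" using assms by simp
  have "card (proper_colorings (signed_book m n) k) = card (SIGMA p:?P. {1..n} \<rightarrow>\<^sub>E ?S p)"
    by (rule bij_betw_same_card[OF bij_betw_proper_colorings_signed_book[OF assms]])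
  also have "\<dots> = (\<Sum>p \<in> ?P. card (?S p) ^ n)"
    by (subst card_SigmaI) (auto simp: card_PiE finite_PiE finite_page_colorings)
  finally have "int (card (proper_colorings (signed_book m n) k)) = (\<Sum>p \<in> ?P. int (card (?S p)) ^ n)"
    by simp
  also have "\<dots> = (\<Sum>p \<in> ?P. if fst p = snd p then (?w + (-1) ^ (m - 1)) ^ n else ?w ^ n)"
  proof (rule sum.cong)
    fix p assume "p \<in> ?P"
    then have "fst p \<in> ?C" "snd p \<in> ?C" by auto
    then have "int (card (?S p)) = walks (int (card ?C)) (Suc (m - 2)) +
        (if fst p = snd p then (-1) ^ Suc (m - 2) else 0)"
      by (intro card_page_colorings) auto
    also have "int (card ?C) = 2 * int k + 1" by simp
    finally show "int (card (?S p)) ^ n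
        = (if fst p = snd p then (?w + (-1) ^ (m - 1)) ^ n else ?w ^ n)"
      unfolding m by simp
  qed simp
  also have "\<dots> = 2 * int k * (?w + (-1) ^ (m - 1)) ^ n + (2 * int k)\<^sup>2 * ?w ^ n"
    by (rule sum_nonopposite_pairs)
  finally show ?thesis .
qed

section \<open>The chromatic polynomial and the two formulas\<close>

text \<open>Since \<open>walks\<close> commutes with evaluation, the count is the value at
  \<open>2 * k + 1\<close> of this polynomial, with \<open>X - 1\<close> giving
  \<open>2 * k\<close>. These values determine the polynomial.\<close>

lemma chromatic_poly_signed_book:
  fixes m n :: nat
  assumes "m \<ge> 3" "n \<ge> 1"
  defines "X \<equiv> [:0, 1:] :: int poly"
  shows "chromatic_poly (signed_book m n) =
    (X - 1) * (walks X (m - 1) + (-1) ^ (m - 1)) ^ n + (X - 1)\<^sup>2 * walks X (m - 1) ^ n"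
  by (rule chromatic_poly_eqI)
    (simp add: is_chromatic_poly_def card_proper_colorings_signed_book[OF assms(1,2)]
      poly_walks X_def)

text \<open>In the fraction field \<open>walks\<close> becomes \<open>gam\<close>, and
  \<open>gam_diff\<close> absorbs the sign in the diagonal count.\<close>

lemma chi_book_closed_form:
  assumes "m \<ge> 3" "n \<ge> 1"
  shows "chi_book m n =
    (lam - 1) * ((lam - 1) * gam (m - 1)) ^ n + (lam - 1)\<^sup>2 * gam m ^ n"
proof -
  have m: "Suc (m - Suc 0) = m" using assms by simp
  have "to_fract (-1 :: int poly) = -1"
    by (metis to_fract_1 to_fract_uminus)
  then have "chi_book m n =
      (lam - 1) * (gam m + (-1) ^ (m - 1)) ^ n + (lam - 1)\<^sup>2 * gam m ^ n"
    unfolding chromatic_poly_signed_book[OF assms]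
    by (simp add: to_fract_power to_fract_walks walks_lam m flip: lam_def)
  also have "gam m + (-1) ^ (m - 1) = (lam - 1) * gam (m - 1)"
    using gam_diff[OF assms(1)] by (simp add: algebra_simps)
  finally show ?thesis .
qed

theorem theorem3p8:
  fixes m n :: nat
  assumes "m \<ge> 3" and "n \<ge> 2"
  shows "chi_book m n =
           (lam - 1) * gam (m - 1) * chi_book m (n - 1)
           + (-1) ^ (m - 2) * (lam - 1)\<^sup>2 * gam m ^ (n - 1)
       \<and> chi_book m n =
           (lam - 1) ^ (m + n - 1) * gam (m - 1) ^ (n - 1)
           + (-1) ^ (m - 2) * gam m * (lam - 1)\<^sup>2 *
             (((lam - 1) ^ (n - 1) * gam (m - 1) ^ (n - 1) - gam m ^ (n - 1))
              / ((lam - 1) * gam (m - 1) - gam m))"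
proof -
  define A where "A = (lam - 1) * gam (m - 1)"
  define e :: "int poly fract" where "e = (-1) ^ (m - 2)"
  \<comment> \<open>Here \<open>n \<ge> 2\<close> enters: \<open>l \<ge> 1\<close> lets the closed
    form apply to \<open>n - 1\<close> pages too.\<close>
  obtain l where n: "n = Suc l" and l: "l \<ge> 1" using assms(2) by (cases n) auto
  have m: "m - 1 = Suc (m - 2)" "m = Suc (Suc (m - 2))" using assms(1) by auto
  have e2: "e * e = 1" by (simp add: e_def flip: power_mult_distrib)
  have A: "A - gam m = - e"
    using gam_diff[OF assms(1)] m(1) by (simp add: A_def e_def)
  have chi: "chi_book m (Suc l) = (lam - 1) * A ^ Suc l + (lam - 1)\<^sup>2 * gam m ^ Suc l"
    "chi_book m l = (lam - 1) * A ^ l + (lam - 1)\<^sup>2 * gam m ^ l"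
    using chi_book_closed_form[OF assms(1)] l by (simp_all add: A_def)
  have g: "gam m = A + e" using A by (simp add: algebra_simps)
  \<comment> \<open>The terms in \<open>gam m ^ l\<close> combine with the factor
    \<open>A + e = gam m\<close>, which raises the exponent by one.\<close>
  have "chi_book m (Suc l) = A * chi_book m l + e * (lam - 1)\<^sup>2 * gam m ^ l"
    unfolding chi by (simp add: g algebra_simps)
  moreover have "chi_book m (Suc l) = (lam - 1) ^ m * A ^ l
      + e * gam m * (lam - 1)\<^sup>2 * ((A ^ l - gam m ^ l) / (A - gam m))"
  proof -
    \<comment> \<open>The recursion of \<open>walks\<close> makes two consecutive values sum to a
      power of \<open>lam - 1\<close>. It follows that \<open>(lam - 1) ^ m\<close> is the closed
      form for a single page.\<close>
    have "gam (m - 1) = walks lam (m - 2)" "gam m = walks lam (Suc (m - 2))"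
      unfolding walks_lam by (simp_all only: m(1) flip: m(2))
    then have "gam (m - 1) + gam m = (lam - 1) ^ (m - 2)" by simp
    then have "(lam - 1) ^ m = (lam - 1)\<^sup>2 * (gam (m - 1) + gam m)"
      using m(2) by (metis add_2_eq_Suc power_add)
    then have lm: "(lam - 1) ^ m = (lam - 1) * A + (lam - 1)\<^sup>2 * gam m"
      by (simp add: A_def algebra_simps power2_eq_square)
    \<comment> \<open>The denominator is \<open>- e\<close>, so the factor \<open>e\<close> cancels
      it up to sign.\<close>
    have "e \<noteq> 0" using e2 by auto
    then have "e * gam m * (lam - 1)\<^sup>2 * ((A ^ l - gam m ^ l) / (A - gam m))
        = (lam - 1)\<^sup>2 * gam m * (gam m ^ l - A ^ l)"
      unfolding A by (simp add: field_simps)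
    then show ?thesis unfolding chi lm by (simp add: algebra_simps)
  qed
  moreover have "(lam - 1) ^ m * A ^ l = (lam - 1) ^ (m + n - 1) * gam (m - 1) ^ l"
    by (simp add: A_def n power_mult_distrib power_add)
  moreover have "n - 1 = l" by (simp add: n)
  ultimately show ?thesis
    by (simp only: n A_def e_def power_mult_distrib)
qed

end
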